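(* Let $a,b$ be coprime positive integers with $b>1$, and let $D$ be a $0$-stable chip configuration. (a) $D$ is $(b-1)$-skeletal (superstable) if and only if $\mathrm{lpath}(D)$ is a labeled $(a,b)$-Dyck path. (b) $D$ is $0$-skeletal if and only if $\widehat{\mathrm{lpath}(D)}$ is a labeled inverted $(a,b)$-Dyck path. (c) The map $D\mapsto D'$ with $D'(i)=a-e-D(i)$ for $i\in[b]$, where $e=1+\lfloor a/b\rfloor$, is a bijection from superstable configurations to $0$-skeletal configurations.
   Context: Write $[b]=\{1,\dots,b\}$. A chip configuration is $D:[b]\to\mathbb{Z}$; $D\ge0$ means all values nonnegative. For $S\subseteq[b]$ with $|S|=s$, $\phi_S$ subtracts $1+\lfloor (b-s)a/b\rfloor$ from $D(i)$ for $i\in S$ and adds $\lfloor sa/b\rfloor$ to $D(j)$ for $j\in[b]\setminus S$; $\beta_S=\phi_S^{-1}$; for $D\ge0$ these are legal if the result is $\ge0$. For $0\le k<b$: a $k$-firing move is $\phi_S$ with $0<|S|\le k+1$; $D\ge0$ is $k$-stable if no $k$-firing move is legal on it; superstable means $(b-1)$-stable; $D$ is $k$-skeletal if $k$-stable and for every nonempty $T$ with $\beta_T$ legal on $D$, $\beta_T(D)$ is not $k$-stable. $\mathrm{lpath}(D)$ for $D\ge0$: $i$ is poorer than $j$ if $D(i)<D(j)$ or ($D(i)=D(j)$ and $i<j$); with $w_1,\dots,w_b$ the vertices from poorest to richest and $x_t=D(w_t)$, $\mathrm{lpath}(D)$ is the path from $(0,0)$ having a north step from $(x_t,t-1)$ to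 $(x_t,t)$ labeled $w_t$ for each $t$, joined by east steps, ending with east steps from $(x_b,b)$ to $(a,b)$. The level of $(x,y)$ is $ay-bx$. A labeled $(a,b)$-Dyck path is such a labeled path from $(0,0)$ to $(a,b)$ (labels increasing bottom to top within each maximal run of north steps) all of whose north steps start at level $\ge0$. For a $0$-stable $D$, $\mathrm{lpath}(D)$ ends with at least $e=1+\lfloor a/b\rfloor$ east steps, and $\widehat{\mathrm{lpath}(D)}$ is the labeled path from $(-e,0)$ to $(a-e,b)$ obtained by moving its last $e$ east steps to the beginning. A labeled inverted $(a,b)$-Dyck path is a labeled lattice path from $(-e,0)$ to $(a-e,b)$ staying in the closed triangle with vertices $(-e,0)$, $(a-e,0)$, $(a-e,b)$. *)

theory Defs
  imports "HOL-Analysis.Analysis"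
begin

section \<open>Chip configurations\<close>

text \<open>Configurations are extensional functions, so that equality of configurations is
  equality of their values on \<open>{1..b}\<close>.\<close>

definition chip_configs :: "nat \<Rightarrow> (nat \<Rightarrow> int) set" where
  "chip_configs b = {1..b} \<rightarrow>\<^sub>E UNIV"

definition nonneg_config :: "nat \<Rightarrow> (nat \<Rightarrow> int) \<Rightarrow> bool" where
  "nonneg_config b D \<longleftrightarrow> (\<forall>i\<in>{1..b}. 0 \<le> D i)"

definition fire :: "nat \<Rightarrow> nat \<Rightarrow> nat set \<Rightarrow> (nat \<Rightarrow> int) \<Rightarrow> (nat \<Rightarrow> int)" where
  "fire a b S D = (\<lambda>i\<in>{1..b}.
     if i \<in> S then D i - (1 + int ((b - card S) * a div b))
     else D i + int (card S * a div b))"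

definition borrow :: "nat \<Rightarrow> nat \<Rightarrow> nat set \<Rightarrow> (nat \<Rightarrow> int) \<Rightarrow> (nat \<Rightarrow> int)" where
  "borrow a b S = inv_into (chip_configs b) (fire a b S)"

lemma fire_in_configs: "fire a b S D \<in> chip_configs b"
  by (auto simp: fire_def chip_configs_def)

lemma inj_on_fire: "inj_on (fire a b S) (chip_configs b)"
proof (rule inj_onI)
  fix D D' assume D: "D \<in> chip_configs b" "D' \<in> chip_configs b"
    and eq: "fire a b S D = fire a b S D'"
  have "D i = D' i" if "i \<in> {1..b}" for i
    using fun_cong[OF eq, of i] that by (auto simp: fire_def split: if_splits)
  then show "D = D'"
    using D unfolding chip_configs_def by (intro PiE_ext) auto
qed

lemma borrow_eq:
  assumes "D \<in> chip_configs b"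
  shows "borrow a b S D = (\<lambda>i\<in>{1..b}.
     if i \<in> S then D i + (1 + int ((b - card S) * a div b))
     else D i - int (card S * a div b))" (is "_ = ?B")
proof -
  have B: "?B \<in> chip_configs b" by (auto simp: chip_configs_def)
  have "fire a b S ?B i = D i" for i
  proof (cases "i \<in> {1..b}")
    case True
    then show ?thesis by (simp add: fire_def)
  next
    case False
    then have "D i = undefined" "fire a b S ?B i = undefined"
      using assms fire_in_configs[of a b S ?B] unfolding chip_configs_def
      by (blast intro: PiE_arb)+
    then show ?thesis by simp
  qed
  then have "fire a b S ?B = D" by blast
  then show ?thesis
    unfolding borrow_def using inv_into_f_f[OF inj_on_fire B, of a S] by (simp only:)
qed

definition k_stable :: "nat \<Rightarrow> nat \<Rightarrow> nat \<Rightarrow> (nat \<Rightarrow> int) \<Rightarrow> bool" where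
  "k_stable a b k D \<longleftrightarrow> nonneg_config b D \<and>
     \<not> (\<exists>S \<subseteq> {1..b}. 0 < card S \<and> card S \<le> k + 1 \<and> nonneg_config b (fire a b S D))"

definition superstable :: "nat \<Rightarrow> nat \<Rightarrow> (nat \<Rightarrow> int) \<Rightarrow> bool" where
  "superstable a b D \<longleftrightarrow> k_stable a b (b - 1) D"

definition k_skeletal :: "nat \<Rightarrow> nat \<Rightarrow> nat \<Rightarrow> (nat \<Rightarrow> int) \<Rightarrow> bool" where
  "k_skeletal a b k D \<longleftrightarrow> k_stable a b k D \<and>
     (\<forall>T \<subseteq> {1..b}. T \<noteq> {} \<and> nonneg_config b (borrow a b T D) \<longrightarrow>
        \<not> k_stable a b k (borrow a b T D))"


section \<open>Labeled lattice paths\<close>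

datatype step = East | North nat

type_synonym labeled_path = "(int \<times> int) \<times> step list"  \<comment> \<open>starting point and steps\<close>

fun advance :: "int \<times> int \<Rightarrow> step \<Rightarrow> int \<times> int" where
  "advance (x, y) East = (x + 1, y)"
| "advance (x, y) (North l) = (x, y + 1)"

definition position :: "labeled_path \<Rightarrow> nat \<Rightarrow> int \<times> int" where
  "position P n = foldl advance (fst P) (take n (snd P))"

definition end_point :: "labeled_path \<Rightarrow> int \<times> int" where
  "end_point P = position P (length (snd P))"

fun labels :: "step list \<Rightarrow> nat list" where
  "labels [] = []"
| "labels (East # s) = labels s"
| "labels (North l # s) = l # labels s"

text \<open>Each label of \<open>{1..b}\<close> is used exactly once, and labels increase along consecutive
  north steps, i.e. within each maximal run of north steps.\<close>

definition labeled_lattice_path ::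
    "nat \<Rightarrow> int \<times> int \<Rightarrow> int \<times> int \<Rightarrow> labeled_path \<Rightarrow> bool" where
  "labeled_lattice_path b p q P \<longleftrightarrow> fst P = p \<and> end_point P = q \<and>
     distinct (labels (snd P)) \<and> set (labels (snd P)) = {1..b} \<and>
     (\<forall>n i j. Suc n < length (snd P) \<and> snd P ! n = North i \<and> snd P ! Suc n = North j \<longrightarrow> i < j)"

definition level :: "nat \<Rightarrow> nat \<Rightarrow> int \<times> int \<Rightarrow> int" where
  "level a b p = int a * snd p - int b * fst p"

definition labeled_dyck_path :: "nat \<Rightarrow> nat \<Rightarrow> labeled_path \<Rightarrow> bool" where
  "labeled_dyck_path a b P \<longleftrightarrow> labeled_lattice_path b (0, 0) (int a, int b) P \<and>
     (\<forall>n l. n < length (snd P) \<and> snd P ! n = North l \<longrightarrow> 0 \<le> level a b (position P n))"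

definition real_point :: "int \<times> int \<Rightarrow> real \<times> real" where
  "real_point p = (of_int (fst p), of_int (snd p))"

definition path_trace :: "labeled_path \<Rightarrow> (real \<times> real) set" where
  "path_trace P = (\<Union>n<length (snd P).
     closed_segment (real_point (position P n)) (real_point (position P (Suc n))))"

definition e_const :: "nat \<Rightarrow> nat \<Rightarrow> nat" where
  "e_const a b = 1 + a div b"

definition labeled_inverted_dyck_path :: "nat \<Rightarrow> nat \<Rightarrow> labeled_path \<Rightarrow> bool" where
  "labeled_inverted_dyck_path a b P \<longleftrightarrow> (let e = int (e_const a b) in
     labeled_lattice_path b (- e, 0) (int a - e, int b) P \<and>
     path_trace P \<subseteq> convex hull {real_point (- e, 0), real_point (int a - e, 0),
                             real_point (int a - e, int b)})"


section \<open>The path of a configuration\<close>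

definition poorer :: "(nat \<Rightarrow> int) \<Rightarrow> nat \<Rightarrow> nat \<Rightarrow> bool" where
  "poorer D i j \<longleftrightarrow> D i < D j \<or> D i = D j \<and> i < j"

text \<open>Sorting by \<open>D\<close> is stable, so ties keep the increasing order of the labels; this is the
  enumeration of the vertices from poorest to richest.\<close>

definition wealth_order :: "nat \<Rightarrow> (nat \<Rightarrow> int) \<Rightarrow> nat list" where
  "wealth_order b D = sort_key D [1..<Suc b]"

lemma wealth_order_set: "set (wealth_order b D) = {1..b}"
  by (auto simp: wealth_order_def)

lemma wealth_order_distinct: "distinct (wealth_order b D)"
  by (simp add: wealth_order_def)

lemma wealth_order_sorted: "sorted_wrt (poorer D) (wealth_order b D)"
proof -
  have ins: "sorted_wrt (poorer D) (insort_key D x xs)"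
    if "sorted_wrt (poorer D) xs" "\<forall>y\<in>set xs. x < y" for x xs
    using that
  proof (induction xs)
    case (Cons y ys)
    then show ?case by (auto simp: poorer_def set_insort_key)
  qed simp
  have "sorted_wrt (poorer D) (sort_key D xs)" if "sorted_wrt (<) xs" for xs
    using that by (induction xs) (auto intro!: ins)
  then show ?thesis by (simp add: wealth_order_def del: upt_Suc)
qed

text \<open>\<open>walk a D x ws\<close> are the steps of the part of the path that starts at abscissa \<open>x\<close>,
  with north steps labeled \<open>ws\<close> at abscissas \<open>map D ws\<close>, up to the abscissa \<open>a\<close>.\<close>

fun walk :: "nat \<Rightarrow> (nat \<Rightarrow> int) \<Rightarrow> int \<Rightarrow> nat list \<Rightarrow> step list" where
  "walk a D x [] = replicate (nat (int a - x)) East"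
| "walk a D x (w # ws) = replicate (nat (D w - x)) East @ North w # walk a D (D w) ws"

definition lpath :: "nat \<Rightarrow> nat \<Rightarrow> (nat \<Rightarrow> int) \<Rightarrow> labeled_path" where
  "lpath a b D = ((0, 0), walk a D 0 (wealth_order b D))"

text \<open>Moving the last \<open>e\<close> steps of a path from the origin to its beginning; for \<open>0\<close>-stable
  configurations the moved steps are east steps (see \<open>lpath_ends_east\<close>).\<close>

definition lpath_hat :: "nat \<Rightarrow> nat \<Rightarrow> (nat \<Rightarrow> int) \<Rightarrow> labeled_path" where
  "lpath_hat a b D = (let e = e_const a b; s = snd (lpath a b D); m = length s - e in
     ((- int e, 0), drop m s @ take m s))"

lemma walk_ends_east:
  assumes "\<forall>w\<in>set ws. D w + int e \<le> int a" "x + int e \<le> int a"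
  shows "\<exists>s. walk a D x ws = s @ replicate e East"
  using assms
proof (induction ws arbitrary: x)
  case Nil
  then have "nat (int a - x) = nat (int a - x - int e) + e" by linarith
  then show ?case by (metis replicate_add walk.simps(1))
next
  case (Cons w ws)
  then obtain s where "walk a D (D w) ws = s @ replicate e East" by force
  then show ?case by simp
qed

lemma stable0_bound:
  assumes "b > 1" "coprime a b" "k_stable a b 0 D" "i \<in> {1..b}"
  shows "D i + int (e_const a b) \<le> int a"
proof -
  have nn: "nonneg_config b D" using assms(3) by (simp add: k_stable_def)
  have "\<not> (\<exists>S \<subseteq> {1..b}. 0 < card S \<and> card S \<le> 0 + 1 \<and> nonneg_config b (fire a b S D))"
    using assms(3) unfolding k_stable_def by blast
  moreover have "{i} \<subseteq> {1..b}" "0 < card {i}" "card {i} \<le> 0 + 1" using assms(4) by auto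
  ultimately have "\<not> nonneg_config b (fire a b {i} D)" by blast
  then obtain j where j: "j \<in> {1..b}" "fire a b {i} D j < 0"
    unfolding nonneg_config_def by force
  have "0 \<le> D j" using nn j(1) by (simp add: nonneg_config_def)
  with j have "j = i" by (auto simp: fire_def split: if_splits)
  with j have D: "D i < 1 + int ((b - 1) * a div b)" by (auto simp: fire_def)
  have "\<not> b dvd a"
    using assms(1,2) by (metis coprime_absorb_right less_irrefl nat_dvd_1_iff_1)
  then have r: "a mod b > 0" "a mod b < b" using assms(1) by (auto simp: dvd_eq_mod_eq_0)
  have "(b - 1) * a + a mod b = b * (a - a div b)"
  proof -
    have "(b - 1) * a + a = b * a" using assms(1) by (cases b) auto
    moreover have "b * (a div b) + a mod b = a" by (rule mult_div_mod_eq)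
    ultimately have "(b - 1) * a + a mod b + b * (a div b) = b * a" by linarith
    then show ?thesis unfolding diff_mult_distrib2 by linarith
  qed
  then have "(b - 1) * a < b * (a - a div b)" using r by linarith
  then have "(b - 1) * a div b < a - a div b"
    by (simp add: less_mult_imp_div_less mult.commute)
  then show ?thesis using D unfolding e_const_def by linarith
qed

lemma lpath_ends_east:
  assumes "b > 1" "coprime a b" "k_stable a b 0 D"
  shows "\<exists>s. snd (lpath a b D) = s @ replicate (e_const a b) East"
proof -
  have "D 1 \<ge> 0" using assms by (auto simp: k_stable_def nonneg_config_def)
  then have "0 + int (e_const a b) \<le> int a"
    using stable0_bound[OF assms, of 1] assms(1) by auto
  then show ?thesis
    unfolding lpath_def using stable0_bound[OF assms]
    by (auto intro!: walk_ends_east simp: wealth_order_set)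
qed

end

theory Submission
  imports Defs
begin

text \<open>Firing \<open>S\<close> is illegal iff some \<open>i \<in> S\<close> satisfies \<open>b * D i \<le> (b - |S|) * a\<close>, so superstability
  is a condition on all nonempty subsets; testing it on the sets of richest vertices gives the
  Dyck condition. Borrowing at \<open>T\<close> from \<open>D\<close> keeps \<open>D\<close> 0-stable essentially iff firing \<open>T\<close> is
  legal on the complement \<open>i \<mapsto> a - e - D i\<close>, so that \<open>D\<close> is 0-skeletal iff its complement is
  superstable; tested on the sets of poorest vertices this says that the upper ends of the
  north steps of the shifted path lie below the hypotenuse of the triangle.\<close>

section \<open>Stability as a condition on subsets\<close>

text \<open>Turns the floors in the moves into linear inequalities. For negative \<open>z\<close>
  both sides hold, since the quotient and \<open>m\<close> are nonnegative; otherwise this is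
  division of natural numbers.\<close>

lemma int_le_div_iff:
  assumes "b > 0"
  shows "z \<le> int (m div b) \<longleftrightarrow> int b * z \<le> int m"
proof (cases z)
  case (nonneg n)
  then show ?thesis
    using assms less_eq_div_iff_mult_less_eq[of b n m]
    by (simp only: of_nat_le_iff of_nat_mult[symmetric] mult.commute)
next
  case (neg n)
  then have "int b * z \<le> 0" "z < 0" using mult_nonneg_nonpos[of "int b" z] by simp_all
  then show ?thesis by linarith
qed

text \<open>Only members of \<open>S\<close> lose chips, so only they can become negative. The extra
  1 in the amount fired is what makes the inequality strict.\<close>

lemma nonneg_fire_iff:
  assumes "nonneg_config b D" "S \<subseteq> {1..b}" "b > 0"
  shows "nonneg_config b (fire a b S D) \<longleftrightarrow>
    (\<forall>i\<in>S. int ((b - card S) * a) < int b * D i)"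
proof -
  have "nonneg_config b (fire a b S D) \<longleftrightarrow>
      (\<forall>i\<in>S. \<not> D i \<le> int ((b - card S) * a div b))"
    using assms(1,2) unfolding nonneg_config_def fire_def
    by (auto simp: not_le subset_iff simp del: of_nat_div of_nat_mult; force)
  then show ?thesis by (simp only: int_le_div_iff[OF assms(3)] not_le)
qed

lemma k_stable_iff:
  assumes "b > 0"
  shows "k_stable a b k D \<longleftrightarrow> nonneg_config b D \<and>
    (\<forall>S\<subseteq>{1..b}. S \<noteq> {} \<and> card S \<le> k + 1 \<longrightarrow>
      (\<exists>i\<in>S. int b * D i \<le> int ((b - card S) * a)))"
proof -
  have "0 < card S \<longleftrightarrow> S \<noteq> {}" if "S \<subseteq> {1..b}" for S
    using that by (meson card_gt_0_iff finite_atLeastAtMost finite_subset)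
  then show ?thesis
    unfolding k_stable_def using nonneg_fire_iff[OF _ _ assms, of D _ a]
    by (meson not_le)
qed

lemma superstable_iff:
  assumes "b > 0"
  shows "superstable a b D \<longleftrightarrow> nonneg_config b D \<and>
    (\<forall>S\<subseteq>{1..b}. S \<noteq> {} \<longrightarrow> (\<exists>i\<in>S. int b * D i \<le> int ((b - card S) * a)))"
proof -
  have "card S \<le> b - 1 + 1" if "S \<subseteq> {1..b}" for S
    using card_mono[OF _ that] assms by simp
  then show ?thesis unfolding superstable_def k_stable_iff[OF assms] by blast
qed

lemma superstable_imp_k_stable:
  assumes "b > 0" "superstable a b D"
  shows "k_stable a b k D"
  using assms(2) unfolding superstable_iff[OF assms(1)] k_stable_iff[OF assms(1)] by blast

lemma b_times_e:
  "int b * int (e_const a b) = int b + int a - int (a mod b)"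
proof -
  have "int b * int (a div b) = int a - int (a mod b)"
    by (simp add: zdiv_int zmod_int minus_mod_eq_mult_div)
  then show ?thesis by (simp add: e_const_def algebra_simps)
qed

text \<open>A single vertex cannot fire as long as it holds at most floor((b-1)a/b) chips, and this
  floor is a - e because b does not divide a. Hence the 0-stable configurations form a box that
  complementation maps to itself.\<close>

lemma stable0_iff:
  assumes "b > 1" "coprime a b"
  shows "k_stable a b 0 D \<longleftrightarrow>
    (\<forall>i\<in>{1..b}. 0 \<le> D i \<and> D i \<le> int a - int (e_const a b))" (is "?L \<longleftrightarrow> ?R")
proof
  assume ?L
  then show ?R
    using stable0_bound[OF assms] by (force simp: k_stable_def nonneg_config_def)
next
  assume R: ?R
  have "\<exists>i\<in>S. int b * D i \<le> int ((b - card S) * a)"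
    if S: "S \<subseteq> {1..b}" "S \<noteq> {} \<and> card S \<le> 0 + 1" for S
  proof -
    have "finite S" using S(1) finite_subset by blast
    then have "card S \<noteq> 0" using S(2) by simp
    then have "card S = 1" using S(2) by linarith
    then obtain i where i: "S = {i}" by (rule card_1_singletonE)
    have "int b * D i \<le> int b * (int a - int (e_const a b))"
      using R S(1) i by (intro mult_left_mono) auto
    also have "\<dots> = int b * int a - int b - int a + int (a mod b)"
      using b_times_e[of b a] by (simp add: algebra_simps)
    \<comment> \<open>The remainder \<open>a mod b\<close> is below \<open>b\<close>, so the
      rounding inside \<open>e\<close> is absorbed.\<close>
    also have "\<dots> \<le> int b * int a - int a"
      using assms(1) by (simp flip: of_nat_mod add: less_imp_le)
    also have "\<dots> = int ((b - 1) * a)"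
      using assms(1) by (simp add: of_nat_diff algebra_simps)
    finally show ?thesis using i by simp
  qed
  then show ?L using R assms(1) by (simp add: k_stable_iff nonneg_config_def)
qed

section \<open>Borrowing moves and skeletal configurations\<close>

lemma fire_borrow:
  assumes "D \<in> chip_configs b"
  shows "fire a b T (borrow a b T D) = D"
proof
  fix i
  show "fire a b T (borrow a b T D) i = D i"
    using PiE_arb[OF assms[unfolded chip_configs_def], of i]
    by (cases "i \<in> {1..b}") (simp_all add: borrow_eq[OF assms] fire_def del: of_nat_div)
qed

text \<open>Firing \<open>T\<close> undoes borrowing at \<open>T\<close> and leads back to the
  nonnegative \<open>D\<close>. As every \<open>T\<close> has at most \<open>b\<close> members, no
  configuration reached by borrowing is (b-1)-stable.\<close>

lemma superstable_iff_skeletal: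
  assumes "b > 0" "D \<in> chip_configs b"
  shows "k_skeletal a b (b - 1) D \<longleftrightarrow> superstable a b D"
proof
  assume D: "superstable a b D"
  have "\<not> k_stable a b (b - 1) (borrow a b T D)" if T: "T \<subseteq> {1..b}" "T \<noteq> {}" for T
  proof -
    have "0 < card T" "card T \<le> b - 1 + 1"
      using T card_mono[OF _ T(1)] assms(1) by (auto simp: card_gt_0_iff finite_subset)
    moreover have "nonneg_config b (fire a b T (borrow a b T D))"
      using D fire_borrow[OF assms(2)] by (simp add: superstable_def k_stable_def)
    ultimately show ?thesis using T unfolding k_stable_def by blast
  qed
  then show "k_skeletal a b (b - 1) D"
    using D unfolding k_skeletal_def superstable_def by blast
qed (simp add: k_skeletal_def superstable_def)

text \<open>Borrowing at \<open>T\<close> leaves \<open>D\<close> 0-stable iff firing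
  \<open>T\<close> is legal on the complement \<open>E\<close> and every vertex outside
  \<open>T\<close> can pay its share. For a largest legal \<open>T\<close> the second condition is
  automatic, so only the absence of legal sets has to be tested.\<close>

lemma stable0_skeletal_iff:
  assumes b: "b > 1" and ab: "coprime a b" and D: "D \<in> chip_configs b"
    and st: "k_stable a b 0 D"
  shows "k_skeletal a b 0 D \<longleftrightarrow>
    (\<forall>S\<subseteq>{1..b}. S \<noteq> {} \<longrightarrow>
      (\<exists>i\<in>S. int (card S * a) \<le> int b * (D i + int (e_const a b))))" (is "_ \<longleftrightarrow> ?R")
proof -
  define e where "e = int (e_const a b)"
  define E where "E i = int a - e - D i" for i
  have bound: "0 \<le> D i" "D i \<le> int a - e" if "i \<in> {1..b}" for i
    using st that by (auto simp: stable0_iff[OF b ab] e_def)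
  define legal where "legal S \<longleftrightarrow> (\<forall>i\<in>S. int ((b - card S) * a div b) < E i)" for S
  have legal_iff: "legal S \<longleftrightarrow> (\<forall>i\<in>S. int b * (D i + e) < int (card S * a))"
    if "S \<subseteq> {1..b}" for S
  proof -
    have "card S \<le> b" using card_mono[OF _ that] by simp
    then have "int ((b - card S) * a) < int b * E i \<longleftrightarrow>
        int b * (D i + e) < int (card S * a)" for i
      by (simp add: E_def of_nat_diff algebra_simps)
    moreover have "legal S \<longleftrightarrow> (\<forall>i\<in>S. int ((b - card S) * a) < int b * E i)"
      unfolding legal_def using int_le_div_iff[of b _ "(b - card S) * a"] b by (simp add: not_le[symmetric])
    ultimately show ?thesis by simp
  qed
  \<comment> \<open>By the box description, members of \<open>T\<close> gain chips and can only
    violate the upper bound, the others lose chips and can only violate the lower one.\<close>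
  have stable_borrow: "k_stable a b 0 (borrow a b T D) \<longleftrightarrow>
      legal T \<and> (\<forall>j\<in>{1..b} - T. int (card T * a div b) \<le> D j)" if T: "T \<subseteq> {1..b}" for T
  proof -
    have "k_stable a b 0 (borrow a b T D) \<longleftrightarrow>
      (\<forall>i\<in>{1..b}. if i \<in> T then int ((b - card T) * a div b) < E i
         else int (card T * a div b) \<le> D i)"
      unfolding stable0_iff[OF b ab]
    proof (intro ball_cong refl)
      fix i assume i: "i \<in> {1..b}"
      have "0 \<le> int ((b - card T) * a div b)" "0 \<le> int (card T * a div b)" by simp_all
      with bound[OF i] i show "(0 \<le> borrow a b T D i \<and> borrow a b T D i \<le> int a - int (e_const a b)) \<longleftrightarrow>
          (if i \<in> T then int ((b - card T) * a div b) < E i else int (card T * a div b) \<le> D i)"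
        unfolding borrow_eq[OF D] e_def[symmetric] E_def
        by (simp del: of_nat_div of_nat_mult) linarith
    qed
    then show ?thesis unfolding legal_def using T by auto
  qed
  have "(\<exists>T\<subseteq>{1..b}. T \<noteq> {} \<and> k_stable a b 0 (borrow a b T D)) \<longleftrightarrow>
      (\<exists>T\<subseteq>{1..b}. T \<noteq> {} \<and> legal T)"
  proof
    assume "\<exists>T\<subseteq>{1..b}. T \<noteq> {} \<and> legal T"
    then obtain T0 where T0: "T0 \<subseteq> {1..b} \<and> T0 \<noteq> {} \<and> legal T0" by blast
    \<comment> \<open>Cardinalities are bounded by \<open>b\<close>, so a largest legal set
      exists.\<close>
    have "\<forall>S. S \<subseteq> {1..b} \<and> S \<noteq> {} \<and> legal S \<longrightarrow> card S < Suc b"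
      using card_mono[of "{1..b}"] by (simp add: less_Suc_eq_le)
    from ex_has_greatest_nat[OF T0 this]
    obtain T where T: "T \<subseteq> {1..b}" "T \<noteq> {}" "legal T"
      and max: "\<And>S. S \<subseteq> {1..b} \<Longrightarrow> S \<noteq> {} \<Longrightarrow> legal S \<Longrightarrow> card S \<le> card T"
      by (elim exE conjE) simp
    \<comment> \<open>By maximality of \<open>T\<close>, firing \<open>insert j T\<close> fails at \<open>j\<close>, and that bounds \<open>D j\<close> from below.\<close>
    have "int (card T * a div b) \<le> D j" if j: "j \<in> {1..b} - T" for j
    proof -
      have "finite T" using T(1) finite_subset by blast
      then have card: "card (insert j T) = Suc (card T)" using j by simp
      then have "\<not> legal (insert j T)" using max[of "insert j T"] T(1) j by fastforce
      then obtain i where i: "i \<in> insert j T" "int (Suc (card T) * a) \<le> int b * (D i + e)"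
        using legal_iff[of "insert j T"] T(1) j card by (auto simp: not_less)
      \<comment> \<open>For members of \<open>T\<close> the legality condition only loosens when the
        set grows, so the failing vertex is the new one.\<close>
      have "i \<notin> T" using T(3) i(2) unfolding legal_iff[OF T(1)] by (fastforce simp: not_less[symmetric])
      then have "int (card T * a) + int a \<le> int b * D j + int b * e"
        using i by (simp add: algebra_simps)
      \<comment> \<open>A positive remainder gives b*e < a + b, which cancels the additional
        \<open>a\<close> and leaves a strict inequality with D j + 1.\<close>
      moreover have "a mod b > 0"
        using b ab by (metis coprime_absorb_right less_irrefl mod_greater_zero_iff_not_dvd nat_dvd_1_iff_1)
      ultimately have "int (card T * a) < int b * (D j + 1)"
        using b_times_e[of b a] unfolding e_def by (simp add: algebra_simps)
      then have "\<not> D j + 1 \<le> int (card T * a div b)"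
        using int_le_div_iff[of b] b by (simp add: not_le)
      then show ?thesis by linarith
    qed
    then show "\<exists>T\<subseteq>{1..b}. T \<noteq> {} \<and> k_stable a b 0 (borrow a b T D)"
      using T stable_borrow[OF T(1)] by blast
  qed (use stable_borrow in blast)
  moreover have "k_skeletal a b 0 D \<longleftrightarrow>
      \<not> (\<exists>T\<subseteq>{1..b}. T \<noteq> {} \<and> k_stable a b 0 (borrow a b T D))"
    using st unfolding k_skeletal_def by (auto simp: k_stable_def)
  moreover have "?R \<longleftrightarrow> \<not> (\<exists>T\<subseteq>{1..b}. T \<noteq> {} \<and> legal T)"
    using legal_iff unfolding e_def by (meson not_le)
  ultimately show ?thesis by blast
qed

section \<open>Subset conditions on a sorted list\<close>

text \<open>Suffixes are the extremal sets. If \<open>t\<close> is the first position of a member of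
  \<open>S\<close>, then \<open>S\<close> lies in the suffix from \<open>t\<close>, and antitony
  carries the condition from there to \<open>S\<close>. Conversely, a witness in that suffix has
  value at least \<open>D (ws ! t)\<close>, so the first entry is a witness too.\<close>

lemma subsets_iff_suffixes:
  fixes D :: "'a \<Rightarrow> 'b::linorder"
  assumes dist: "distinct ws" and sort: "sorted (map D ws)"
    and anti: "\<And>m n x y. P m x \<Longrightarrow> n \<le> m \<Longrightarrow> y \<le> x \<Longrightarrow> P n y"
  shows "(\<forall>S\<subseteq>set ws. S \<noteq> {} \<longrightarrow> (\<exists>i\<in>S. P (card S) (D i))) \<longleftrightarrow>
    (\<forall>t<length ws. P (length ws - t) (D (ws ! t)))" (is "?L \<longleftrightarrow> ?R")
proof
  assume L: ?L
  show ?R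
  proof (intro allI impI)
    fix t assume t: "t < length ws"
    then have "set (drop t ws) \<noteq> {}" by simp
    with L obtain i where i: "i \<in> set (drop t ws)" "P (card (set (drop t ws))) (D i)"
      using set_drop_subset[of t ws] by blast
    have card: "card (set (drop t ws)) = length ws - t"
      using dist by (simp add: distinct_card)
    from i(1) obtain n where n: "n < length ws - t" "i = ws ! (t + n)"
      using t by (auto simp: in_set_conv_nth)
    have "D (ws ! t) \<le> D i"
      using sorted_nth_mono[OF sort, of t "t + n"] n t by simp
    then show "P (length ws - t) (D (ws ! t))"
      using anti[OF i(2)] card by simp
  qed
next
  assume R: ?R
  show ?L
  proof (intro allI impI)
    fix S assume S: "S \<subseteq> set ws" "S \<noteq> {}"
    then have ex: "\<exists>t. t < length ws \<and> ws ! t \<in> S"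
      by (metis equals0I in_set_conv_nth subsetD)
    define t where "t = (LEAST t. t < length ws \<and> ws ! t \<in> S)"
    have t: "t < length ws" "ws ! t \<in> S"
      using LeastI_ex[OF ex] unfolding t_def by simp_all
    have "S \<subseteq> set (drop t ws)"
    proof
      fix x assume x: "x \<in> S"
      with S obtain n where n: "n < length ws" "x = ws ! n" by (metis in_set_conv_nth subsetD)
      then have "t \<le> n" using x unfolding t_def by (intro Least_le) simp
      then have "drop t ws ! (n - t) = x" "n - t < length (drop t ws)" using n by auto
      then show "x \<in> set (drop t ws)" by (metis nth_mem)
    qed
    then have "card S \<le> length ws - t"
      using card_mono[of "set (drop t ws)" S] card_length[of "drop t ws"] by simp
    then have "P (card S) (D (ws ! t))" using R t anti by blast
    then show "\<exists>i\<in>S. P (card S) (D i)" using t by blast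
  qed
qed

text \<open>The order dual: reversing the list and negating \<open>D\<close> turns prefixes into
  suffixes.\<close>

lemma subsets_iff_prefixes:
  fixes D :: "'a \<Rightarrow> int"
  assumes dist: "distinct ws" and sort: "sorted (map D ws)"
    and mono: "\<And>m n x y. P m x \<Longrightarrow> n \<le> m \<Longrightarrow> x \<le> y \<Longrightarrow> P n y"
  shows "(\<forall>S\<subseteq>set ws. S \<noteq> {} \<longrightarrow> (\<exists>i\<in>S. P (card S) (D i))) \<longleftrightarrow>
    (\<forall>t<length ws. P (Suc t) (D (ws ! t)))"
proof -
  have "sorted (map (\<lambda>i. - D i) (rev ws))"
    using sort by (simp add: sorted_wrt_rev rev_map[symmetric] sorted_wrt_map)
  then have "(\<forall>S\<subseteq>set (rev ws). S \<noteq> {} \<longrightarrow> (\<exists>i\<in>S. P (card S) (- (- D i)))) \<longleftrightarrow>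
      (\<forall>t<length (rev ws). P (length (rev ws) - t) (- (- D (rev ws ! t))))"
    using dist mono by (intro subsets_iff_suffixes[where P = "\<lambda>n x. P n (- x)"]) auto
  also have "\<dots> \<longleftrightarrow> (\<forall>t<length ws. P (Suc t) (D (ws ! t)))"
  proof (intro iffI allI impI)
    \<comment> \<open>Position \<open>length ws - Suc t\<close> of the reversed list is position
      \<open>t\<close> of \<open>ws\<close>, and the reversed suffix from there has
      \<open>Suc t\<close> entries.\<close>
    fix t assume *: "\<forall>t<length (rev ws). P (length (rev ws) - t) (- (- D (rev ws ! t)))" "t < length ws"
    then show "P (Suc t) (D (ws ! t))"
      using spec[OF *(1), of "length ws - Suc t"] by (simp add: rev_nth)
  next
    fix t assume *: "\<forall>t<length ws. P (Suc t) (D (ws ! t))" "t < length (rev ws)"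
    then show "P (length (rev ws) - t) (- (- D (rev ws ! t)))"
      using spec[OF *(1), of "length ws - Suc t"] by (simp add: rev_nth Suc_diff_Suc)
  qed
  finally show ?thesis by simp
qed

section \<open>The subset conditions along the wealth order\<close>

lemma wealth_order_length: "length (wealth_order b D) = b"
  by (simp add: wealth_order_def del: upt_Suc)

lemma wealth_order_sorted_map: "sorted (map D (wealth_order b D))"
  by (simp add: wealth_order_def del: upt_Suc)

text \<open>The worst sets consist of the b - t richest vertices, for which (b - card S) a equals t
  a. The inequality says that the lower end of the north step at height t has level at least
  0.\<close>

lemma superstable_iff_wealth_order:
  assumes "b > 0" "nonneg_config b D"
  shows "superstable a b D \<longleftrightarrow>
    (\<forall>t<b. int b * D (wealth_order b D ! t) \<le> int a * int t)"
proof -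
  let ?P = "\<lambda>n x. int b * x \<le> int ((b - n) * a)"
  have anti: "?P n y" if "?P m x" "n \<le> m" "y \<le> x" for m n x y
  proof -
    have "int b * y \<le> int b * x" using that by (simp add: mult_left_mono)
    also have "\<dots> \<le> int ((b - m) * a)" by (rule that)
    also have "\<dots> \<le> int ((b - n) * a)"
      using that(2) by (intro of_nat_mono mult_right_mono diff_le_mono2) simp_all
    finally show ?thesis .
  qed
  have "superstable a b D \<longleftrightarrow> (\<forall>t<b. ?P (b - t) (D (wealth_order b D ! t)))"
    using assms subsets_iff_suffixes[where P = ?P and ws = "wealth_order b D" and D = D,
      OF wealth_order_distinct wealth_order_sorted_map anti]
    by (simp only: superstable_iff wealth_order_set wealth_order_length) simp
  then show ?thesis by (simp add: mult.commute)
qed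

text \<open>Here the worst sets consist of the t + 1 poorest vertices. The inequality bounds the
  upper end of the north step at height t, with abscissas measured from -e.\<close>

lemma skeletal_iff_wealth_order:
  assumes "b > 1" "coprime a b" "D \<in> chip_configs b" "k_stable a b 0 D"
  shows "k_skeletal a b 0 D \<longleftrightarrow>
    (\<forall>t<b. int a * (int t + 1) \<le> int b * (D (wealth_order b D ! t) + int (e_const a b)))"
proof -
  let ?P = "\<lambda>n x. int (n * a) \<le> int b * (x + int (e_const a b))"
  have mono: "?P n y" if "?P m x" "n \<le> m" "x \<le> y" for m n x y
  proof -
    have "int (n * a) \<le> int (m * a)" using that(2) by (intro of_nat_mono mult_right_mono) simp_all
    also have "\<dots> \<le> int b * (x + int (e_const a b))" by (rule that)
    also have "\<dots> \<le> int b * (y + int (e_const a b))" using that by (simp add: mult_left_mono)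
    finally show ?thesis .
  qed
  have "k_skeletal a b 0 D \<longleftrightarrow> (\<forall>t<b. ?P (Suc t) (D (wealth_order b D ! t)))"
    using assms subsets_iff_prefixes[where P = ?P and ws = "wealth_order b D" and D = D,
      OF wealth_order_distinct wealth_order_sorted_map mono]
    by (simp only: stable0_skeletal_iff wealth_order_set wealth_order_length)
  then show ?thesis by (simp add: algebra_simps)
qed

section \<open>North steps of lattice paths\<close>

text \<open>Each north step is recorded by its label and its lower end. The list does not change
  when east steps move from the end to the beginning and the start moves left accordingly.\<close>

fun norths :: "int \<times> int \<Rightarrow> step list \<Rightarrow> (nat \<times> int \<times> int) list" where
  "norths p [] = []"
| "norths p (East # s) = norths (advance p East) s"
| "norths p (North l # s) = (l, p) # norths (advance p (North l)) s"

lemma norths_append: "norths p (s @ s') = norths p s @ norths (foldl advance p s) s'"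
  by (induction p s rule: norths.induct) auto

lemma norths_replicate_East [simp]: "norths p (replicate n East) = []"
  by (induction n arbitrary: p) auto

lemma foldl_advance_replicate_East [simp]:
  "foldl advance (x, y) (replicate n East) = (x + int n, y)"
  by (induction n arbitrary: x) auto

lemma labels_eq_norths: "labels s = map fst (norths p s)"
  by (induction p s rule: norths.induct) auto

lemma set_norths:
  "(l, q) \<in> set (norths (fst P) (snd P)) \<longleftrightarrow>
    (\<exists>n<length (snd P). snd P ! n = North l \<and> q = position P n)"
proof -
  have "(l, q) \<in> set (norths p s) \<longleftrightarrow>
      (\<exists>n<length s. s ! n = North l \<and> q = foldl advance p (take n s))" for p s
    by (induction p s rule: norths.induct) (auto simp: Ex_less_Suc2)
  then show ?thesis by (simp add: position_def)
qed

lemma position_Suc: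
  assumes "n < length (snd P)"
  shows "position P (Suc n) = advance (position P n) (snd P ! n)"
  using assms by (simp add: position_def take_Suc_conv_app_nth)

text \<open>Sortedness and the bounds make all differences under \<open>nat\<close> nonnegative, so
  each stretch of east steps ends exactly at the next abscissa. The induction needs an arbitrary
  starting point.\<close>

lemma walk_norths:
  assumes "sorted (map D ws)" "\<forall>w\<in>set ws. x \<le> D w \<and> D w \<le> int a" "x \<le> int a"
  shows "norths (x, y) (walk a D x ws) =
      map (\<lambda>t. (ws ! t, D (ws ! t), y + int t)) [0..<length ws]"
    and "foldl advance (x, y) (walk a D x ws) = (int a, y + int (length ws))"
proof -
  have "norths (x, y) (walk a D x ws) =
      map (\<lambda>t. (ws ! t, D (ws ! t), y + int t)) [0..<length ws] \<and>
    foldl advance (x, y) (walk a D x ws) = (int a, y + int (length ws))"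
    using assms
  proof (induction ws arbitrary: x y)
    case (Cons w ws)
    have "norths (D w, y + 1) (walk a D (D w) ws) =
        map (\<lambda>t. (ws ! t, D (ws ! t), (y + 1) + int t)) [0..<length ws] \<and>
      foldl advance (D w, y + 1) (walk a D (D w) ws) = (int a, (y + 1) + int (length ws))"
      using Cons.prems by (intro Cons.IH) auto
    then show ?case
      using Cons.prems
      by (simp add: norths_append upt_conv_Cons map_Suc_upt[symmetric] comp_def ac_simps del: upt_Suc)
  qed simp
  then show "norths (x, y) (walk a D x ws) =
      map (\<lambda>t. (ws ! t, D (ws ! t), y + int t)) [0..<length ws]"
    and "foldl advance (x, y) (walk a D x ws) = (int a, y + int (length ws))" by simp_all
qed

text \<open>Consecutive north steps share their abscissa, so their labels are neighbours in the
  wealth order with a tie in \<open>D\<close>.\<close>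

lemma labeled_lattice_path_if_norths:
  assumes "norths (fst P) (snd P) =
      map (\<lambda>t. (wealth_order b D ! t, D (wealth_order b D ! t), int t)) [0..<b]"
    and "fst P = p" "foldl advance p (snd P) = q"
  shows "labeled_lattice_path b p q P"
proof -
  let ?w = "wealth_order b D"
  have labels: "labels (snd P) = ?w"
    by (rule nth_equalityI) (simp_all add: labels_eq_norths[of _ "fst P"] assms(1) wealth_order_length)
  have north: "\<exists>t<b. l = ?w ! t \<and> position P n = (D (?w ! t), int t)"
    if "n < length (snd P)" "snd P ! n = North l" for n l
  proof -
    have "(l, position P n) \<in> set (norths (fst P) (snd P))"
      unfolding set_norths using that by blast
    then show ?thesis unfolding assms(1) by auto
  qed
  have "i < j" if n: "Suc n < length (snd P)" "snd P ! n = North i" "snd P ! Suc n = North j" for n i j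
  proof -
    obtain t where t: "i = ?w ! t" "position P n = (D (?w ! t), int t)"
      using north[OF Suc_lessD[OF n(1)] n(2)] by blast
    obtain u where u: "u < b" "j = ?w ! u" "position P (Suc n) = (D (?w ! u), int u)"
      using north[OF n(1,3)] by blast
    have "position P (Suc n) = (D (?w ! t), int t + 1)"
      using t(2) n(2) position_Suc[OF Suc_lessD[OF n(1)]] by simp
    then have "u = Suc t" "D i = D j" using t u by auto
    then show ?thesis
      using sorted_wrt_nth_less[OF wealth_order_sorted, of t u b D] t u
      by (simp add: wealth_order_length poorer_def)
  qed
  then show ?thesis
    unfolding labeled_lattice_path_def end_point_def position_def
    using assms(2,3) labels wealth_order_distinct wealth_order_set by auto
qed

text \<open>Serves both the level condition and the triangle condition, which constrain only the
  lower ends of north steps.\<close>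

lemma ball_norths:
  assumes "norths (fst P) (snd P) = map (\<lambda>t. (w t, x t, y t)) [0..<b]"
  shows "(\<forall>n l. n < length (snd P) \<and> snd P ! n = North l \<longrightarrow> Q (position P n)) \<longleftrightarrow>
    (\<forall>t<b. Q (x t, y t))"
proof -
  have "(\<forall>n l. n < length (snd P) \<and> snd P ! n = North l \<longrightarrow> Q (position P n)) \<longleftrightarrow>
      (\<forall>l q. (l, q) \<in> set (norths (fst P) (snd P)) \<longrightarrow> Q q)"
    unfolding set_norths by blast
  also have "\<dots> \<longleftrightarrow> (\<forall>z\<in>set (norths (fst P) (snd P)). Q (snd z))" by force
  finally show ?thesis unfolding assms by auto
qed

section \<open>Paths inside the triangle\<close>

text \<open>The three inequalities express that the barycentric coordinates of the point are
  nonnegative.\<close>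

lemma mem_triangle_iff:
  fixes e x y :: int
  assumes "a > 0" "b > 0"
  shows "real_point (x, y) \<in> convex hull {real_point (- e, 0), real_point (int a - e, 0),
      real_point (int a - e, int b)} \<longleftrightarrow>
    0 \<le> y \<and> x \<le> int a - e \<and> int a * y \<le> int b * (x + e)" (is "?L \<longleftrightarrow> ?R")
proof
  assume ?L
  then obtain u v w :: real where uvw: "0 \<le> u" "0 \<le> v" "0 \<le> w" "u + v + w = 1"
    and "real_point (x, y) = u *\<^sub>R real_point (- e, 0) + v *\<^sub>R real_point (int a - e, 0)
      + w *\<^sub>R real_point (int a - e, int b)"
    unfolding convex_hull_3 by blast
  then have x: "real_of_int x = - u * e + v * (a - e) + w * (a - e)"
    and y: "real_of_int y = w * b" by (simp_all add: real_point_def)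
  have v: "v = 1 - u - w" using uvw by simp
  have x': "real_of_int x = (1 - u) * a - e" unfolding x v by (simp add: field_simps)
  have "0 \<le> real_of_int y" using uvw y by simp
  then have "0 \<le> y" by simp
  moreover have "real_of_int x \<le> real_of_int (int a - e)"
    using mult_nonneg_nonneg[OF uvw(1), of a] x' by (simp add: algebra_simps)
  then have "x \<le> int a - e" by (simp only: of_int_le_iff)
  moreover have "int a * y \<le> int b * (x + e)"
  proof -
    have "real b * (real_of_int x + e) - real a * y = v * (real a * real b)"
      unfolding x' y v by (simp add: algebra_simps)
    also have "\<dots> \<ge> 0" using uvw by simp
    finally have "real_of_int (int a * y) \<le> real_of_int (int b * (x + e))" by simp
    then show ?thesis by (simp only: of_int_le_iff)
  qed
  ultimately show ?R by blast
next
  assume R: ?R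
  \<comment> \<open>Solving for the coordinates: \<open>w\<close> is fixed by the height,
    \<open>u\<close> by the distance to the right edge, and \<open>v\<close> is the slack at the
    hypotenuse divided by \<open>a * b\<close>.\<close>
  define u v w :: real where "u = (a - e - x) / a" and "v = (x + e) / a - y / b" and "w = y / b"
  have "real_of_int (int a * y) \<le> real_of_int (int b * (x + e))" using R by (simp only: of_int_le_iff)
  then have "0 \<le> v" using assms by (simp add: v_def field_simps)
  moreover have "0 \<le> u" "0 \<le> w" using R assms by (simp_all add: u_def w_def field_simps)
  moreover have "u + v + w = 1"
    using assms by (simp add: u_def v_def w_def field_simps)
  moreover have "real_point (x, y) = u *\<^sub>R real_point (- e, 0) + v *\<^sub>R real_point (int a - e, 0)
      + w *\<^sub>R real_point (int a - e, int b)"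
    using assms by (simp add: real_point_def u_def v_def w_def field_simps)
  ultimately show ?L unfolding convex_hull_3 by blast
qed

text \<open>A convex set contains a segment as soon as it contains both ends. A path without steps
  has an empty trace but still a position, hence the second assumption.\<close>

lemma path_trace_subset_convex_iff:
  assumes "convex K" "snd P \<noteq> []"
  shows "path_trace P \<subseteq> K \<longleftrightarrow> (\<forall>n\<le>length (snd P). real_point (position P n) \<in> K)"
proof
  assume K: "path_trace P \<subseteq> K"
  show "\<forall>n\<le>length (snd P). real_point (position P n) \<in> K"
  proof (intro allI impI)
    fix n assume n: "n \<le> length (snd P)"
    show "real_point (position P n) \<in> K"
    proof (cases n)
      case 0
      then have "real_point (position P n) \<in> path_trace P"
        using assms(2) unfolding path_trace_def by (auto intro!: bexI[of _ 0])
      then show ?thesis using K by blast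
    next
      case (Suc m)
      then have "real_point (position P n) \<in> path_trace P"
        using n unfolding path_trace_def by (auto intro!: bexI[of _ m])
      then show ?thesis using K by blast
    qed
  qed
next
  assume K: "\<forall>n\<le>length (snd P). real_point (position P n) \<in> K"
  have "closed_segment (real_point (position P n)) (real_point (position P (Suc n))) \<subseteq> K"
    if "n < length (snd P)" for n
    using K that by (intro closed_segment_subset assms(1)) simp_all
  then show "path_trace P \<subseteq> K" unfolding path_trace_def by blast
qed

text \<open>The slack b(x + e) - a y is 0 at the start and grows along east steps, so the hypotenuse
  can be crossed only at the upper end of a north step.\<close>

lemma path_trace_in_triangle_iff:
  assumes "a > 0" "b > 0" "fst P = (- e, 0)" "end_point P = (int a - e, int b)"
  shows "path_trace P \<subseteq> convex hull {real_point (- e, 0), real_point (int a - e, 0),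
      real_point (int a - e, int b)} \<longleftrightarrow>
    (\<forall>n l. n < length (snd P) \<and> snd P ! n = North l \<longrightarrow>
      int a * (snd (position P n) + 1) \<le> int b * (fst (position P n) + e))" (is "?L \<longleftrightarrow> ?R")
proof -
  have ne: "snd P \<noteq> []"
  proof
    assume "snd P = []"
    then show False using assms by (simp add: end_point_def position_def)
  qed
  let ?ok = "\<lambda>p. 0 \<le> snd p \<and> fst p \<le> int a - e \<and> int a * snd p \<le> int b * (fst p + e)"
  have "?L \<longleftrightarrow> (\<forall>n\<le>length (snd P). ?ok (position P n))"
    unfolding path_trace_subset_convex_iff[OF convex_convex_hull ne]
    using mem_triangle_iff[OF assms(1,2), of "fst p" "snd p" e for p] by simp
  also have "\<dots> \<longleftrightarrow> ?R"
  proof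
    assume ok: "\<forall>n\<le>length (snd P). ?ok (position P n)"
    show ?R
    proof (intro allI impI)
      fix n l assume n: "n < length (snd P) \<and> snd P ! n = North l"
      then have "?ok (position P (Suc n))" using ok by simp
      then show "int a * (snd (position P n) + 1) \<le> int b * (fst (position P n) + e)"
        using n position_Suc[of n P] by (cases "position P n") simp
    qed
  next
    assume R: ?R
    have low: "n \<le> length (snd P) \<Longrightarrow> 0 \<le> snd (position P n) \<and>
        int a * snd (position P n) \<le> int b * (fst (position P n) + e)" for n
    proof (induction n)
      case 0
      then show ?case using assms(3) by (simp add: position_def)
    next
      case (Suc n)
      then have IH: "0 \<le> snd (position P n)"
        "int a * snd (position P n) \<le> int b * (fst (position P n) + e)"
        and n: "n < length (snd P)" by simp_all
      obtain x y where xy: "position P n = (x, y)" by (cases "position P n")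
      show ?case
      proof (cases "snd P ! n")
        case East
        then show ?thesis using IH xy position_Suc[OF n] by (simp add: algebra_simps)
      next
        case (North l)
        then have "int a * (y + 1) \<le> int b * (x + e)" using R n xy by fastforce
        then show ?thesis using North IH xy position_Suc[OF n] by simp
      qed
    qed
    \<comment> \<open>Abscissas never decrease, so the right edge is controlled by induction
      backwards from the end point.\<close>
    have "fst (position P n) \<le> int a - e" if "n \<le> length (snd P)" for n
      using that
    proof (induction n rule: inc_induct)
      case base
      then show ?case using assms(4) by (simp add: end_point_def)
    next
      case (step n)
      then show ?case
        using position_Suc[of n P] by (cases "position P n"; cases "snd P ! n") auto
    qed
    with low show "\<forall>n\<le>length (snd P). ?ok (position P n)" by simp
  qed
  finally show ?thesis .
qed

section \<open>The paths of a configuration and the Dyck conditions\<close>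

lemma lpath_norths:
  assumes "\<forall>i\<in>{1..b}. 0 \<le> D i \<and> D i \<le> int a"
  shows "norths (0, 0) (snd (lpath a b D)) =
      map (\<lambda>t. (wealth_order b D ! t, D (wealth_order b D ! t), int t)) [0..<b]"
    and "foldl advance (0, 0) (snd (lpath a b D)) = (int a, int b)"
  using walk_norths[OF wealth_order_sorted_map, of b D 0 a 0] assms
  by (simp_all add: lpath_def wealth_order_set wealth_order_length)

lemma lpath_labeled_dyck_path_iff:
  assumes "\<forall>i\<in>{1..b}. 0 \<le> D i \<and> D i \<le> int a"
  shows "labeled_dyck_path a b (lpath a b D) \<longleftrightarrow>
    (\<forall>t<b. int b * D (wealth_order b D ! t) \<le> int a * int t)"
proof -
  have fst: "fst (lpath a b D) = (0, 0)" by (simp add: lpath_def)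
  note N = lpath_norths(1)[OF assms, folded fst]
  show ?thesis
    unfolding labeled_dyck_path_def ball_norths[OF N, of "\<lambda>p. 0 \<le> level a b p"]
    using labeled_lattice_path_if_norths[OF N fst lpath_norths(2)[OF assms]]
    by (simp add: level_def)
qed

text \<open>Starting at -e and prepending e east steps leaves every north step of
  \<open>lpath a b D\<close> in place, so the same list of north steps can be tested against the
  triangle.\<close>

lemma lpath_hat_labeled_inverted_dyck_path_iff:
  assumes b: "b > 1" and ab: "a > 0" "coprime a b" and st: "k_stable a b 0 D"
  shows "labeled_inverted_dyck_path a b (lpath_hat a b D) \<longleftrightarrow>
    (\<forall>t<b. int a * (int t + 1) \<le> int b * (D (wealth_order b D ! t) + int (e_const a b)))"
proof -
  define e where "e = e_const a b"
  have D: "\<forall>i\<in>{1..b}. 0 \<le> D i \<and> D i \<le> int a"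
    using st by (auto simp: stable0_iff[OF b ab(2)])
  obtain s where s: "snd (lpath a b D) = s @ replicate e East"
    using lpath_ends_east[OF b ab(2) st] e_def by blast
  have hat: "lpath_hat a b D = ((- int e, 0), replicate e East @ s)"
    by (simp add: lpath_hat_def e_def[symmetric] s)
  have s_end: "foldl advance (0, 0) s = (int a - int e, int b)"
    using lpath_norths(2)[OF D] unfolding s
    by (cases "foldl advance (0, 0) s") simp
  have N: "norths (fst (lpath_hat a b D)) (snd (lpath_hat a b D)) =
      map (\<lambda>t. (wealth_order b D ! t, D (wealth_order b D ! t), int t)) [0..<b]"
    using lpath_norths(1)[OF D] by (simp add: hat s norths_append)
  have path: "labeled_lattice_path b (- int e, 0) (int a - int e, int b) (lpath_hat a b D)"
    by (rule labeled_lattice_path_if_norths[OF N]) (simp_all add: hat s_end)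
  have "labeled_inverted_dyck_path a b (lpath_hat a b D) \<longleftrightarrow>
    (\<forall>n l. n < length (snd (lpath_hat a b D)) \<and> snd (lpath_hat a b D) ! n = North l \<longrightarrow>
      int a * (snd (position (lpath_hat a b D) n) + 1)
        \<le> int b * (fst (position (lpath_hat a b D) n) + int e))"
    unfolding labeled_inverted_dyck_path_def Let_def e_def[symmetric]
    using path path_trace_in_triangle_iff[of a b "lpath_hat a b D" "int e"] ab b
    by (simp add: labeled_lattice_path_def)
  also have "\<dots> \<longleftrightarrow> (\<forall>t<b. int a * (int t + 1) \<le> int b * (D (wealth_order b D ! t) + int e))"
    using ball_norths[OF N, of "\<lambda>p. int a * (snd p + 1) \<le> int b * (fst p + int e)"] by simp
  finally show ?thesis by (simp add: e_def)
qed

text \<open>Substituting a - e - D i into the superstability inequality for \<open>S\<close> cancels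
  a b and yields the skeletal inequality for the same \<open>S\<close> and \<open>i\<close>.\<close>

lemma skeletal_iff_complement_superstable:
  assumes b: "b > 1" and ab: "coprime a b" and D: "D \<in> chip_configs b"
    and st: "k_stable a b 0 D"
  shows "k_skeletal a b 0 D \<longleftrightarrow>
    superstable a b (\<lambda>i\<in>{1..b}. int a - int (e_const a b) - D i)" (is "_ \<longleftrightarrow> superstable a b ?E")
proof -
  have "nonneg_config b ?E" using st by (simp add: nonneg_config_def stable0_iff[OF b ab])
  moreover have "int b * ?E i \<le> int ((b - card S) * a) \<longleftrightarrow>
      int (card S * a) \<le> int b * (D i + int (e_const a b))"
    if S: "S \<subseteq> {1..b}" and i: "i \<in> S" for S i
  proof -
    \<comment> \<open>This makes the natural subtraction \<open>b - card S\<close> exact.\<close>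
    have "card S \<le> b" using card_mono[OF _ S] by simp
    moreover have "i \<in> {1..b}" using S i by blast
    ultimately show ?thesis by (simp add: of_nat_diff algebra_simps)
  qed
  ultimately show ?thesis
    unfolding stable0_skeletal_iff[OF assms] using b by (simp add: superstable_iff del: restrict_apply of_nat_mult cong: bex_cong)
qed

theorem theorem4p10:
  fixes a b :: nat
  assumes "a > 0" and "b > 1" and "coprime a b"
  shows "(\<forall>D \<in> chip_configs b. k_stable a b 0 D \<longrightarrow>
            (k_skeletal a b (b - 1) D \<longleftrightarrow> superstable a b D) \<and>
            (k_skeletal a b (b - 1) D \<longleftrightarrow> labeled_dyck_path a b (lpath a b D)) \<and>
            (k_skeletal a b 0 D \<longleftrightarrow> labeled_inverted_dyck_path a b (lpath_hat a b D))) \<and>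
         bij_betw (\<lambda>D. \<lambda>i\<in>{1..b}. int a - int (e_const a b) - D i)
           {D \<in> chip_configs b. superstable a b D}
           {D \<in> chip_configs b. k_skeletal a b 0 D}"
proof (intro conjI ballI impI)
  fix D assume D: "D \<in> chip_configs b" and st: "k_stable a b 0 D"
  show sk: "k_skeletal a b (b - 1) D \<longleftrightarrow> superstable a b D"
    using superstable_iff_skeletal[OF _ D] assms(2) by simp
  have bound: "\<forall>i\<in>{1..b}. 0 \<le> D i \<and> D i \<le> int a" and nn: "nonneg_config b D"
    using st by (auto simp: stable0_iff[OF assms(2,3)] nonneg_config_def)
  show "k_skeletal a b (b - 1) D \<longleftrightarrow> labeled_dyck_path a b (lpath a b D)"
    unfolding sk lpath_labeled_dyck_path_iff[OF bound]
    using assms(2) nn by (simp add: superstable_iff_wealth_order)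
  show "k_skeletal a b 0 D \<longleftrightarrow> labeled_inverted_dyck_path a b (lpath_hat a b D)"
    unfolding lpath_hat_labeled_inverted_dyck_path_iff[OF assms(2,1,3) st]
    by (rule skeletal_iff_wealth_order[OF assms(2,3) D st])
next
  let ?c = "\<lambda>D. \<lambda>i\<in>{1..b}. int a - int (e_const a b) - D i"
  have inC: "?c D \<in> chip_configs b" for D by (auto simp: chip_configs_def)
  have inv: "?c (?c D) = D" if "D \<in> chip_configs b" for D
  proof
    fix i show "?c (?c D) i = D i"
      using PiE_arb[OF that[unfolded chip_configs_def], of i] by (cases "i \<in> {1..b}") simp_all
  qed
  have st: "k_stable a b 0 (?c D)" if "k_stable a b 0 D" for D
    using that by (simp add: stable0_iff[OF assms(2,3)])
  have super: "k_stable a b 0 D" if "superstable a b D" for D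
    using superstable_imp_k_stable[OF _ that] assms(2) by simp
  show "bij_betw ?c {D \<in> chip_configs b. superstable a b D} {D \<in> chip_configs b. k_skeletal a b 0 D}"
  \<comment> \<open>Complementation is an involution on extensional configurations, so it serves as
    its own inverse.\<close>
  proof (rule bij_betw_byWitness[where f' = ?c])
    show "?c ` {D \<in> chip_configs b. superstable a b D} \<subseteq> {D \<in> chip_configs b. k_skeletal a b 0 D}"
    proof clarify
      fix D assume D: "D \<in> chip_configs b" "superstable a b D"
      \<comment> \<open>The duality is applied to \<open>?c D\<close>, whose complement is the
        superstable \<open>D\<close>.\<close>
      have "k_skeletal a b 0 (?c D) \<longleftrightarrow> superstable a b (?c (?c D))"
        by (rule skeletal_iff_complement_superstable[OF assms(2,3) inC st[OF super[OF D(2)]]])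
      with D show "?c D \<in> chip_configs b \<and> k_skeletal a b 0 (?c D)" using inv inC by simp
    qed
    show "?c ` {D \<in> chip_configs b. k_skeletal a b 0 D} \<subseteq> {D \<in> chip_configs b. superstable a b D}"
    proof clarify
      fix D assume D: "D \<in> chip_configs b" "k_skeletal a b 0 D"
      then have "k_stable a b 0 D" by (simp add: k_skeletal_def)
      with D show "?c D \<in> chip_configs b \<and> superstable a b (?c D)"
        using skeletal_iff_complement_superstable[OF assms(2,3)] inC by blast
    qed
  qed (use inv in blast)+
qed

end
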